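(* Let $\mathbb{X},\mathbb{Y}$ be normed linear spaces over the same field $\mathbb{K}\in\{\mathbb{R},\mathbb{C}\}$ and let $T:\mathbb{X}\to\mathbb{Y}$ be a bounded linear operator. Then a nonzero $x\in\mathbb{X}$ is a level vector of $T$ if and only if $T$ preserves Birkhoff-James orthogonality at $x$ with respect to $\ker f$ for some $f\in J(x)$.
   Context: A semi-inner product on a normed space $\mathbb{X}$ over $\mathbb{K}$ is a function $[\cdot,\cdot]:\mathbb{X}\times\mathbb{X}\to\mathbb{K}$ such that for all $\alpha,\beta\in\mathbb{K}$, $x,y,z\in\mathbb{X}$: (1) $[\alpha x+\beta y,z]=\alpha[x,z]+\beta[y,z]$; (2) $[x,x]>0$ whenever $x\neq0$; (3) $|[x,y]|^2\le[x,x][y,y]$; (4) $[x,\alpha y]=\overline{\alpha}[x,y]$. All semi-inner products on a normed space are assumed compatible with the norm: $\|x\|=[x,x]^{1/2}$ for all $x$. For a bounded linear operator $T:\mathbb{X}\to\mathbb{Y}$, a nonzero $x\in\mathbb{X}$ is a level vector of $T$ if there exist a scalar $k$ (a level number of $T$ corresponding to $x$) and semi-inner products $[\cdot,\cdot]_{\mathbb{X}}$ on $\mathbb{X}$ and $[\cdot,\cdot]_{\mathbb{Y}}$ on $\mathbb{Y}$ with $[Ty,Tx]_{\mathbb{Y}}=k[y,x]_{\mathbb{X}}$ for all $y\in\mathbb{X}$. For nonzero $x\in\mathbb{X}$, $J(x)=\{f\in\mathbb{X}^*:\|f\|=1,\ f(x)=\|x\|\}$. Birkhoff-James orthogonality: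 $u\perp_B v$ means $\|u+\lambda v\|\ge\|u\|$ for all scalars $\lambda\in\mathbb{K}$; $x^{\perp_B}=\{v: x\perp_B v\}$. $T$ preserves Birkhoff-James orthogonality at $x$ with respect to a subspace $\mathbb{Z}\subset x^{\perp_B}$ if $Tx\perp_B Tz$ for all $z\in\mathbb{Z}$. (For $f\in J(x)$ one has $\ker f\subset x^{\perp_B}$.) *)

theory Defs
  imports "HOL-Analysis.Analysis"
begin

(* The scalar fields R and C treated uniformly: a scalar type is a field isometrically
   identified with R or C inside complex. The instances real and complex follow. *)
class real_or_complex = real_normed_field +
  fixes to_complex :: "'a \<Rightarrow> complex"
  assumes to_complex_add: "to_complex (x + y) = to_complex x + to_complex y"
    and to_complex_mult: "to_complex (x * y) = to_complex x * to_complex y"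
    and to_complex_scaleR: "to_complex (r *\<^sub>R x) = r *\<^sub>R to_complex x"
    and norm_to_complex: "cmod (to_complex x) = norm x"
    and range_to_complex: "range to_complex = \<real> \<or> range to_complex = UNIV"

instantiation real :: real_or_complex
begin

definition to_complex_real :: "real \<Rightarrow> complex"
  where "to_complex_real = complex_of_real"

instance
  by standard (auto simp: to_complex_real_def Reals_def scaleR_conv_of_real)

end

instantiation complex :: real_or_complex
begin

definition to_complex_complex :: "complex \<Rightarrow> complex"
  where "to_complex_complex z = z"

instance
  by standard (auto simp: to_complex_complex_def)

end

definition scalar_re :: "'k::real_or_complex \<Rightarrow> real"
  where "scalar_re a = Re (to_complex a)"

definition scalar_cnj :: "'k::real_or_complex \<Rightarrow> 'k"
  where "scalar_cnj a = inv to_complex (cnj (to_complex a))"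

lemma to_complex_scalar_cnj:
  fixes a :: "'k::real_or_complex"
  shows "to_complex (scalar_cnj a) = cnj (to_complex a)"
proof -
  have "cnj (to_complex a) \<in> range (to_complex :: 'k \<Rightarrow> complex)"
    using range_to_complex[where 'a='k]
  proof
    assume "range (to_complex :: 'k \<Rightarrow> complex) = \<real>"
    then have "to_complex a \<in> \<real>" by blast
    then have "cnj (to_complex a) = to_complex a" by (simp add: Reals_cnj_iff)
    then show ?thesis by (simp only: rangeI)
  qed simp
  then show ?thesis
    unfolding scalar_cnj_def by (rule f_inv_into_f)
qed

lemma scalar_cnj_real: "scalar_cnj (a::real) = a"
  using to_complex_scalar_cnj[of a] by (simp add: to_complex_real_def)

lemma scalar_cnj_complex: "scalar_cnj (a::complex) = cnj a"
  using to_complex_scalar_cnj[of a] by (simp add: to_complex_complex_def)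

lemma scalar_re_real: "scalar_re (a::real) = a"
  by (simp add: scalar_re_def to_complex_real_def)

lemma scalar_re_complex: "scalar_re (a::complex) = Re a"
  by (simp add: scalar_re_def to_complex_complex_def)

(* A normed space over the scalar type 'k: the type supplies the additive group, the norm and
   the real scaling; the parameter is the multiplication by elements of 'k extending the latter. *)
locale normed_space_over = vector_space scale
  for scale :: "'k::real_or_complex \<Rightarrow> 'a::real_normed_vector \<Rightarrow> 'a" +
  assumes scale_of_real: "scale (of_real r) x = r *\<^sub>R x"
    and norm_scale: "norm (scale a x) = norm a * norm x"

lemma normed_space_over_scaleR: "normed_space_over (scaleR :: real \<Rightarrow> 'a::real_normed_vector \<Rightarrow> 'a)"
  by unfold_locales (auto simp: algebra_simps)

lemma normed_space_over_mult: "normed_space_over ((*) :: 'k::real_or_complex \<Rightarrow> 'k \<Rightarrow> 'k)"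
  by unfold_locales (auto simp: distrib_left distrib_right norm_mult scaleR_conv_of_real mult.assoc)

definition bounded_linear_op ::
  "('k::real_or_complex \<Rightarrow> 'a::real_normed_vector \<Rightarrow> 'a) \<Rightarrow> ('k \<Rightarrow> 'b::real_normed_vector \<Rightarrow> 'b)
    \<Rightarrow> ('a \<Rightarrow> 'b) \<Rightarrow> bool"
  where "bounded_linear_op sX sY T \<longleftrightarrow> Vector_Spaces.linear sX sY T \<and> bounded_linear T"

(* p is not assumed additive in its second argument. The values p x x are real, so
   scalar_re (p x x) is p x x itself; the last condition is compatibility with the norm. *)
definition semi_inner_product ::
  "('k::real_or_complex \<Rightarrow> 'a::real_normed_vector \<Rightarrow> 'a) \<Rightarrow> ('a \<Rightarrow> 'a \<Rightarrow> 'k) \<Rightarrow> bool"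
  where "semi_inner_product s p \<longleftrightarrow>
    (\<forall>a b x y z. p (s a x + s b y) z = a * p x z + b * p y z) \<and>
    (\<forall>x. x \<noteq> 0 \<longrightarrow> p x x \<in> \<real> \<and> scalar_re (p x x) > 0) \<and>
    (\<forall>x y. (norm (p x y))\<^sup>2 \<le> scalar_re (p x x) * scalar_re (p y y)) \<and>
    (\<forall>a x y. p x (s a y) = scalar_cnj a * p x y) \<and>
    (\<forall>x. norm x = sqrt (scalar_re (p x x)))"

definition level_number ::
  "('k::real_or_complex \<Rightarrow> 'a::real_normed_vector \<Rightarrow> 'a) \<Rightarrow> ('k \<Rightarrow> 'b::real_normed_vector \<Rightarrow> 'b)
    \<Rightarrow> ('a \<Rightarrow> 'b) \<Rightarrow> 'a \<Rightarrow> 'k \<Rightarrow> bool"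
  where "level_number sX sY T x k \<longleftrightarrow>
    (\<exists>p q. semi_inner_product sX p \<and> semi_inner_product sY q \<and>
           (\<forall>y. q (T y) (T x) = k * p y x))"

definition level_vector ::
  "('k::real_or_complex \<Rightarrow> 'a::real_normed_vector \<Rightarrow> 'a) \<Rightarrow> ('k \<Rightarrow> 'b::real_normed_vector \<Rightarrow> 'b)
    \<Rightarrow> ('a \<Rightarrow> 'b) \<Rightarrow> 'a \<Rightarrow> bool"
  where "level_vector sX sY T x \<longleftrightarrow> x \<noteq> 0 \<and> (\<exists>k. level_number sX sY T x k)"

(* The set J(x) of norm-one functionals attaining their norm at x. *)
definition support_functionals ::
  "('k::real_or_complex \<Rightarrow> 'a::real_normed_vector \<Rightarrow> 'a) \<Rightarrow> 'a \<Rightarrow> ('a \<Rightarrow> 'k) set"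
  where "support_functionals s x =
    {f. bounded_linear_op s (*) f \<and> onorm f = 1 \<and> f x = of_real (norm x)}"

(* Birkhoff-James orthogonality. *)
definition bj_orthogonal ::
  "('k::real_or_complex \<Rightarrow> 'a::real_normed_vector \<Rightarrow> 'a) \<Rightarrow> 'a \<Rightarrow> 'a \<Rightarrow> bool"
  where "bj_orthogonal s u v \<longleftrightarrow> (\<forall>l. norm (u + s l v) \<ge> norm u)"

definition bj_perp ::
  "('k::real_or_complex \<Rightarrow> 'a::real_normed_vector \<Rightarrow> 'a) \<Rightarrow> 'a \<Rightarrow> 'a set"
  where "bj_perp s x = {v. bj_orthogonal s x v}"

definition preserves_bj_at ::
  "('k::real_or_complex \<Rightarrow> 'a::real_normed_vector \<Rightarrow> 'a) \<Rightarrow> ('k \<Rightarrow> 'b::real_normed_vector \<Rightarrow> 'b)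
    \<Rightarrow> ('a \<Rightarrow> 'b) \<Rightarrow> 'a \<Rightarrow> 'a set \<Rightarrow> bool"
  where "preserves_bj_at sX sY T x Z \<longleftrightarrow>
    module.subspace sX Z \<and> Z \<subseteq> bj_perp sX x \<and> (\<forall>z\<in>Z. bj_orthogonal sY (T x) (T z))"

end

theory Submission
  imports Defs
begin

text \<open>A semi-inner product amounts to a conjugate homogeneous choice of norming functionals
  \<open>y \<mapsto> [y, u] / \<parallel>u\<parallel>\<close>, and the functional at a single point can be prescribed. So
  \<open>x\<close> is a level vector iff some norming functional \<open>g\<close> at \<open>T x\<close> pulls back along \<open>T\<close> to a
  multiple of a norming functional \<open>f\<close> at \<open>x\<close>, that is, iff \<open>g\<close> vanishes on \<open>T (ker f)\<close>. By
  Hahn--Banach such a \<open>g\<close> exists iff \<open>T x\<close> is Birkhoff--James orthogonal to \<open>T (ker f)\<close>.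
  Hahn--Banach itself is obtained from minimal sublinear functionals, which are linear.\<close>

section \<open>Sublinear functionals\<close>

definition sublinear :: "('a::real_vector \<Rightarrow> real) \<Rightarrow> bool"
  where "sublinear p \<longleftrightarrow>
    (\<forall>x y. p (x + y) \<le> p x + p y) \<and> (\<forall>t x. 0 \<le> t \<longrightarrow> p (t *\<^sub>R x) = t * p x)"

lemma sublinear_add: "sublinear p \<Longrightarrow> p (x + y) \<le> p x + p y"
  and sublinear_scaleR: "sublinear p \<Longrightarrow> 0 \<le> t \<Longrightarrow> p (t *\<^sub>R x) = t * p x"
  by (auto simp: sublinear_def)

lemma sublinear_zero: "sublinear p \<Longrightarrow> p 0 = 0"
  using sublinear_scaleR[of p 0 0] by simp

lemma sublinear_minus: "sublinear p \<Longrightarrow> - p (- x) \<le> p x"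
  using sublinear_add[of p x "- x"] sublinear_zero[of p] by simp

text \<open>Applying the one-sided scaling bound to \<open>inverse t\<close> gives the reverse
  inequality. An infimum readily yields only the one-sided form.\<close>

lemma sublinearI:
  assumes add: "\<And>x y. p (x + y) \<le> p x + p y"
    and zero: "p 0 = 0"
    and scale: "\<And>t x. 0 < t \<Longrightarrow> p (t *\<^sub>R x) \<le> t * p x"
  shows "sublinear p"
proof -
  have "t * p x \<le> p (t *\<^sub>R x)" if "0 < t" for t x
    using scale[of "inverse t" "t *\<^sub>R x"] that by (simp add: field_simps)
  then have "p (t *\<^sub>R x) = t * p x" if "0 \<le> t" for t x
    using that scale[of t x] zero by (cases "t = 0") (auto intro: antisym)
  then show ?thesis
    using add by (simp add: sublinear_def)
qed

lemma sublinear_norm: "sublinear norm"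
  by (simp add: sublinear_def norm_triangle_ineq)

text \<open>The witness is the infimum of p(y + c) - a over the pairs (c, a) in \<open>G\<close>;
  the pair with c = -y turns it into the bound -a. A linear functional g below it then satisfies g c
  \<ge> a on \<open>G\<close>.\<close>

lemma sublinear_below_graph:
  fixes p :: "'a::real_vector \<Rightarrow> real" and G :: "('a \<times> real) set"
  assumes p: "sublinear p"
    and zero: "0 \<in> G"
    and add: "\<And>v w. v \<in> G \<Longrightarrow> w \<in> G \<Longrightarrow> v + w \<in> G"
    and scale: "\<And>t v. 0 \<le> t \<Longrightarrow> v \<in> G \<Longrightarrow> t *\<^sub>R v \<in> G"
    and dominated: "\<And>c a. (c, a) \<in> G \<Longrightarrow> a \<le> p c"
  shows "\<exists>q. sublinear q \<and> q \<le> p \<and> (\<forall>(c, a) \<in> G. q (- c) \<le> - a)"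
proof -
  define q where "q y = (INF v\<in>G. p (y + fst v) - snd v)" for y
  \<comment> \<open>The infimum is finite: a \<le> p c \<le> p(y + c) + p(-y).\<close>
  have below: "- p (- y) \<le> p (y + fst v) - snd v" if "v \<in> G" for v y
    using dominated[of "fst v" "snd v"] sublinear_add[OF p, of "y + fst v" "- y"] that by simp
  then have bdd: "bdd_below ((\<lambda>v. p (y + fst v) - snd v) ` G)" for y
    by (meson bdd_belowI2)
  have q_le: "q y \<le> p (y + fst v) - snd v" if "v \<in> G" for v y
    unfolding q_def by (rule cINF_lower[OF bdd that])
  have q_ge: "b \<le> q y" if "\<And>v. v \<in> G \<Longrightarrow> b \<le> p (y + fst v) - snd v" for b y
    unfolding q_def using zero that by (intro cINF_greatest) auto
  have "sublinear q"
  proof (rule sublinearI)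
    fix x y
    \<comment> \<open>The pair \<open>v\<close> is fixed while the infimum over \<open>w\<close> is
      taken; the infimum over \<open>v\<close> follows. The competitor for x + y is v + w.\<close>
    have "q (x + y) - q y \<le> p (x + fst v) - snd v" if v: "v \<in> G" for v
    proof -
      have "q (x + y) - (p (x + fst v) - snd v) \<le> p (y + fst w) - snd w" if "w \<in> G" for w
        using q_le[OF add[OF v that], of "x + y"] sublinear_add[OF p, of "x + fst v" "y + fst w"]
        by (simp add: algebra_simps)
      then show ?thesis
        using q_ge[of "q (x + y) - (p (x + fst v) - snd v)" y] by simp
    qed
    then show "q (x + y) \<le> q x + q y"
      using q_ge[of "q (x + y) - q y" x] by simp
  next
    show "q 0 = 0"
      using q_le[OF zero, of 0] q_ge[of 0 0] sublinear_zero[OF p] dominated by force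
  next
    fix t :: real and x assume t: "0 < t"
    have "q (t *\<^sub>R x) / t \<le> p (x + fst v) - snd v" if "v \<in> G" for v
    proof -
      have "q (t *\<^sub>R x) \<le> p (t *\<^sub>R (x + fst v)) - t * snd v"
        using q_le[OF scale[OF less_imp_le[OF t] that], of "t *\<^sub>R x"]
        by (simp add: scaleR_add_right)
      then show ?thesis
        using t sublinear_scaleR[OF p, of t "x + fst v"] by (simp add: field_simps)
    qed
    then show "q (t *\<^sub>R x) \<le> t * q x"
      using q_ge[of "q (t *\<^sub>R x) / t" x] t by (simp add: field_simps)
  qed
  moreover have "q \<le> p"
    using q_le[OF zero] by (simp add: le_fun_def)
  moreover have "q (- c) \<le> - a" if "(c, a) \<in> G" for c a
    using q_le[OF that, of "- c"] sublinear_zero[OF p] by simp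
  ultimately show ?thesis by blast
qed

text \<open>If \<open>q\<close> is minimal, lowering it along the ray through \<open>u\<close> leaves it unchanged,
  which gives \<open>q y + q u \<le> q (y + u)\<close>.\<close>

lemma linear_minimal_sublinear:
  assumes q: "sublinear q"
    and minimal: "\<And>r. sublinear r \<Longrightarrow> r \<le> q \<Longrightarrow> r = q"
  shows "linear q"
proof -
  have minus: "q (- u) \<le> - q u" for u
  proof -
    define G where "G = {(t *\<^sub>R u, t * q u) |t. 0 \<le> t}"
    have "\<exists>r. sublinear r \<and> r \<le> q \<and> (\<forall>(c, a) \<in> G. r (- c) \<le> - a)"
    proof (rule sublinear_below_graph[OF q])
      show "0 \<in> G"
        unfolding G_def by (rule CollectI, rule exI[of _ 0]) (simp add: zero_prod_def)
      show "v + w \<in> G" if vw: "v \<in> G" "w \<in> G" for v w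
      proof -
        obtain s t where "v = (s *\<^sub>R u, s * q u)" "w = (t *\<^sub>R u, t * q u)" "0 \<le> s" "0 \<le> t"
          using vw by (auto simp: G_def)
        then show ?thesis
          unfolding G_def by (intro CollectI exI[of _ "s + t"]) (simp add: algebra_simps)
      qed
      show "s *\<^sub>R v \<in> G" if s: "0 \<le> s" and v: "v \<in> G" for s v
      proof -
        obtain t where "v = (t *\<^sub>R u, t * q u)" "0 \<le> t"
          using v by (auto simp: G_def)
        then show ?thesis
          unfolding G_def using s by (intro CollectI exI[of _ "s * t"]) simp
      qed
      show "a \<le> q c" if "(c, a) \<in> G" for c a
        using that sublinear_scaleR[OF q] by (auto simp: G_def)
    qed
    then obtain r where r: "sublinear r" "r \<le> q" "\<And>c a. (c, a) \<in> G \<Longrightarrow> r (- c) \<le> - a"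
      by blast
    \<comment> \<open>The point of the ray at t = 1 gives r(-u) \<le> - q u, and minimality turns r
      into q.\<close>
    have "(u, q u) \<in> G"
      unfolding G_def by (rule CollectI, rule exI[of _ 1]) simp
    then show ?thesis
      using r minimal[of r] by auto
  qed
  have neg: "q (- u) = - q u" for u
    using minus[of u] sublinear_minus[OF q, of "- u"] by simp
  show ?thesis
  proof (rule linearI)
    fix x y
    have "q x \<le> q (x + y) + q (- y)"
      using sublinear_add[OF q, of "x + y" "- y"] by simp
    then show "q (x + y) = q x + q y"
      using sublinear_add[OF q, of x y] neg[of y] by simp
  next
    fix t :: real and x
    show "q (t *\<^sub>R x) = t *\<^sub>R q x"
      using sublinear_scaleR[OF q, of t x] sublinear_scaleR[OF q, of "- t" x] neg[of "t *\<^sub>R x"]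
      by (cases "0 \<le> t") auto
  qed
qed

text \<open>Provides the lower bounds for Zorn's lemma. Comparability is what saves subadditivity,
  since a pointwise infimum of sublinear functionals need not be subadditive. The common bound
  \<open>p\<close> keeps the infimum finite, as r y \<ge> - p(-y).\<close>

lemma sublinear_INF_chain:
  fixes C :: "('a::real_vector \<Rightarrow> real) set"
  assumes nonempty: "C \<noteq> {}"
    and sub: "\<And>r. r \<in> C \<Longrightarrow> sublinear r"
    and bound: "\<And>r. r \<in> C \<Longrightarrow> r \<le> p"
    and chain: "\<And>r s. r \<in> C \<Longrightarrow> s \<in> C \<Longrightarrow> r \<le> s \<or> s \<le> r"
  shows "sublinear (\<lambda>y. INF r\<in>C. r y)"
    and "\<And>r. r \<in> C \<Longrightarrow> (\<lambda>y. INF r\<in>C. r y) \<le> r"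
proof -
  define m where "m y = (INF r\<in>C. r y)" for y
  have "- p (- y) \<le> r y" if "r \<in> C" for r y
    using sublinear_minus[OF sub[OF that], of y] le_funD[OF bound[OF that], of "- y"] by linarith
  then have bdd: "bdd_below ((\<lambda>r. r y) ` C)" for y
    by (meson bdd_belowI2)
  have m_le: "m y \<le> r y" if "r \<in> C" for r y
    unfolding m_def by (rule cINF_lower[OF bdd that])
  have m_ge: "b \<le> m y" if "\<And>r. r \<in> C \<Longrightarrow> b \<le> r y" for b y
    unfolding m_def using nonempty that by (intro cINF_greatest) auto
  show "(\<lambda>y. INF r\<in>C. r y) \<le> r" if "r \<in> C" for r
    using m_le[OF that] by (simp add: m_def le_fun_def)
  have "sublinear m"
  proof (rule sublinearI)
    fix x y
    \<comment> \<open>Two members of the chain may be nearly optimal at x and at y; the smaller of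
      the two serves at both points.\<close>
    have *: "m (x + y) \<le> r x + s y" if r: "r \<in> C" and s: "s \<in> C" for r s
      using chain[OF r s]
    proof
      assume "r \<le> s"
      then show ?thesis
        using m_le[OF r, of "x + y"] sublinear_add[OF sub[OF r], of x y] le_funD[of r s y] by linarith
    next
      assume "s \<le> r"
      then show ?thesis
        using m_le[OF s, of "x + y"] sublinear_add[OF sub[OF s], of x y] le_funD[of s r x] by linarith
    qed
    have "m (x + y) - m y \<le> r x" if "r \<in> C" for r
      using m_ge[of "m (x + y) - r x" y] *[OF that] by (simp add: algebra_simps)
    then show "m (x + y) \<le> m x + m y"
      using m_ge[of "m (x + y) - m y" x] by simp
  next
    have "(\<lambda>r. r 0) ` C = {0}"
      using nonempty sublinear_zero[OF sub] by force
    then show "m 0 = 0"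
      by (simp add: m_def)
  next
    fix t :: real and x assume t: "0 < t"
    have "m (t *\<^sub>R x) / t \<le> r x" if "r \<in> C" for r
      using m_le[OF that, of "t *\<^sub>R x"] sublinear_scaleR[OF sub[OF that], of t x] t
      by (simp add: field_simps)
    then show "m (t *\<^sub>R x) \<le> t * m x"
      using m_ge[of "m (t *\<^sub>R x) / t" x] t by (simp add: field_simps)
  qed
  then show "sublinear (\<lambda>y. INF r\<in>C. r y)"
    by (simp add: m_def[abs_def])
qed

lemma linear_below_sublinear:
  fixes p :: "'a::real_vector \<Rightarrow> real"
  assumes p: "sublinear p"
  shows "\<exists>g. linear g \<and> g \<le> p"
proof -
  define A where "A = {r. sublinear r \<and> r \<le> p}"
  have "\<exists>m\<in>A. \<forall>r\<in>A. r \<le> m \<longrightarrow> r = m"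
  proof (rule predicate_Zorn)
    \<comment> \<open>The order is reversed, so the maximal element supplied by Zorn's lemma is a
      minimal sublinear functional.\<close>
    show "partial_order_on A (relation_of (\<lambda>r s. s \<le> r) A)"
      by (rule partial_order_on_relation_ofI) auto
    fix C assume C: "C \<in> Chains (relation_of (\<lambda>r s. s \<le> r) A)"
    have CA: "r \<in> A" if "r \<in> C" for r
      using C that by (auto simp: Chains_def relation_of_def)
    have chain: "r \<le> s \<or> s \<le> r" if "r \<in> C" "s \<in> C" for r s
      using C that by (auto simp: Chains_def relation_of_def)
    show "\<exists>u\<in>A. \<forall>a\<in>C. u \<le> a"
    proof (cases "C = {}")
      case True
      \<comment> \<open>The infimum over an empty family says nothing, so \<open>p\<close> itself
        bounds the empty chain.\<close>
      then show ?thesis using p by (auto simp: A_def)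
    next
      case False
      let ?m = "\<lambda>y. INF r\<in>C. r y"
      have sub: "sublinear r" and bound: "r \<le> p" if "r \<in> C" for r
        using CA[OF that] by (auto simp: A_def)
      note m = sublinear_INF_chain[of C p, OF False sub bound chain]
      obtain r where "r \<in> C" using False by blast
      then have "?m \<in> A"
        using m bound[of r] unfolding A_def by (blast intro: order_trans)
      then show ?thesis
        using m(2) by blast
    qed
  qed
  then obtain m where m: "m \<in> A" "\<And>r. r \<in> A \<Longrightarrow> r \<le> m \<Longrightarrow> r = m"
    by blast
  then have "linear m"
    by (intro linear_minimal_sublinear) (auto simp: A_def intro: order_trans)
  then show ?thesis
    using m(1) by (auto simp: A_def)
qed

text \<open>For \<open>G\<close> the graph of a linear functional on a subspace this is the Hahn--Banach theorem.
  Working with a cone \<open>G\<close> avoids checking that \<open>G\<close> is the graph of a function.\<close>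

lemma linear_between_graph_and_sublinear:
  fixes p :: "'a::real_vector \<Rightarrow> real" and G :: "('a \<times> real) set"
  assumes "sublinear p"
    and "0 \<in> G"
    and "\<And>v w. v \<in> G \<Longrightarrow> w \<in> G \<Longrightarrow> v + w \<in> G"
    and "\<And>t v. 0 \<le> t \<Longrightarrow> v \<in> G \<Longrightarrow> t *\<^sub>R v \<in> G"
    and "\<And>c a. (c, a) \<in> G \<Longrightarrow> a \<le> p c"
  shows "\<exists>g. linear g \<and> g \<le> p \<and> (\<forall>(c, a) \<in> G. a \<le> g c)"
proof -
  obtain q where q: "sublinear q" "q \<le> p" "\<And>c a. (c, a) \<in> G \<Longrightarrow> q (- c) \<le> - a"
    using sublinear_below_graph[OF assms] by blast
  obtain g where g: "linear g" "g \<le> q"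
    using linear_below_sublinear[OF q(1)] by blast
  \<comment> \<open>From g(-c) \<le> q(-c) \<le> -a, by linearity of g.\<close>
  have "a \<le> g c" if "(c, a) \<in> G" for c a
    using q(3)[OF that] le_funD[OF g(2), of "- c"] linear_neg[OF g(1), of c] by simp
  then show ?thesis
    using g q(2) by (auto intro: order_trans)
qed


section \<open>Scalars\<close>

lemma to_complex_zero [simp]: "to_complex (0::'k::real_or_complex) = 0"
  using to_complex_add[of "0::'k" 0] by simp

lemma to_complex_minus [simp]: "to_complex (- a :: 'k::real_or_complex) = - to_complex a"
  using to_complex_add[of a "- a"] by (simp add: add_eq_0_iff)

lemma inj_to_complex: "inj (to_complex :: 'k::real_or_complex \<Rightarrow> complex)"
proof (rule injI)
  fix a b :: 'k assume "to_complex a = to_complex b"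
  then have "to_complex (a + - b) = 0" by (simp only: to_complex_add to_complex_minus) simp
  then show "a = b" using norm_to_complex[of "a + - b"] by simp
qed

lemma to_complex_eq_iff: "to_complex a = to_complex b \<longleftrightarrow> a = (b::'k::real_or_complex)"
  using inj_to_complex by (auto dest: injD)

text \<open>The image of 1 is an idempotent of modulus one.\<close>

lemma to_complex_one [simp]: "to_complex (1::'k::real_or_complex) = 1"
proof -
  have "to_complex (1::'k) * to_complex (1::'k) = to_complex (1::'k)"
    using to_complex_mult[of "1::'k" 1] unfolding mult_1 by (rule sym)
  then show ?thesis using norm_to_complex[of "1::'k"] by auto
qed

lemma to_complex_of_real [simp]: "to_complex (of_real r :: 'k::real_or_complex) = of_real r"
  using to_complex_scaleR[of r "1::'k"] by (simp add: of_real_def)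

lemma scalar_re_of_real [simp]: "scalar_re (of_real r :: 'k::real_or_complex) = r"
  by (simp add: scalar_re_def)

lemma scalar_cnj_mult: "scalar_cnj (a * b) = scalar_cnj a * scalar_cnj (b::'k::real_or_complex)"
  by (subst to_complex_eq_iff[symmetric]) (simp only: to_complex_scalar_cnj to_complex_mult complex_cnj_mult)

lemma scalar_cnj_one [simp]: "scalar_cnj (1::'k::real_or_complex) = 1"
  by (subst to_complex_eq_iff[symmetric]) (simp add: to_complex_scalar_cnj)

lemma scalar_cnj_zero [simp]: "scalar_cnj (0::'k::real_or_complex) = 0"
  by (subst to_complex_eq_iff[symmetric]) (simp add: to_complex_scalar_cnj)

lemma norm_scalar_cnj [simp]: "norm (scalar_cnj a) = norm (a::'k::real_or_complex)"
  using norm_to_complex[of "scalar_cnj a"] norm_to_complex[of a] by (simp add: to_complex_scalar_cnj)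

lemma scalar_cnj_mult_self: "scalar_cnj a * a = of_real ((norm (a::'k::real_or_complex))\<^sup>2)"
proof (subst to_complex_eq_iff[symmetric])
  have "to_complex (scalar_cnj a * a) = of_real ((cmod (to_complex a))\<^sup>2)"
    by (simp only: to_complex_mult to_complex_scalar_cnj complex_norm_square mult.commute)
  then show "to_complex (scalar_cnj a * a) = to_complex (of_real ((norm a)\<^sup>2) :: 'k)"
    by (simp only: norm_to_complex to_complex_of_real)
qed

lemma of_real_scalar_re: "a \<in> \<real> \<Longrightarrow> of_real (scalar_re a) = (a::'k::real_or_complex)"
  by (auto simp: Reals_def)

text \<open>A complex number whose modulus does not exceed its real part has no imaginary part. This
  recovers the full value of a functional from its real part.\<close>

lemma scalar_eq_of_real:
  fixes a :: "'k::real_or_complex"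
  assumes "scalar_re a = r" and "norm a \<le> r"
  shows "a = of_real r"
proof -
  let ?z = "to_complex a"
  have "cmod ?z \<le> Re ?z"
    using assms by (simp add: norm_to_complex scalar_re_def)
  then have "(Re ?z)\<^sup>2 + (Im ?z)\<^sup>2 \<le> (Re ?z)\<^sup>2"
    unfolding cmod_power2[symmetric] by (rule power_mono) simp
  then have "Im ?z = 0" by simp
  then have "?z = of_real r"
    using assms(1) by (simp add: complex_eq_iff scalar_re_def)
  then show ?thesis
    by (subst to_complex_eq_iff[symmetric]) simp
qed


section \<open>Functionals over the scalar field\<close>

lemmas linear_op_zero = module_hom.zero[OF module_hom_linearI]
  and linear_op_add = module_hom.add[OF module_hom_linearI]
  and linear_op_diff = module_hom.diff[OF module_hom_linearI]
  and linear_op_scale = module_hom.scale[OF module_hom_linearI]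

context normed_space_over
begin

lemma linear_functionalI:
  assumes "\<And>y z. f (y + z) = f y + f z" and "\<And>a y. f (scale a y) = a * f y"
  shows "Vector_Spaces.linear scale (*) f"
  unfolding Vector_Spaces.linear_iff
  using assms vector_space_axioms normed_space_over.axioms(1)[OF normed_space_over_mult] by blast

text \<open>Reduces Hahn-Banach over either scalar field to the real case.\<close>

lemma linear_functional_of_real_part:
  fixes g :: "'a \<Rightarrow> real"
  assumes g: "linear g"
  shows "\<exists>f :: 'a \<Rightarrow> 'k. Vector_Spaces.linear scale (*) f \<and> (\<forall>y. scalar_re (f y) = g y)"
proof -
  note g_add = linear_add[OF g] and g_scale = linear_scale[OF g] and g_neg = linear_neg[OF g]
  consider "range (to_complex :: 'k \<Rightarrow> complex) = \<real>" | "range (to_complex :: 'k \<Rightarrow> complex) = UNIV"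
    using range_to_complex by blast
  then show ?thesis
  proof cases
    case 1
    have real: "\<exists>r. a = of_real r" for a :: 'k
    proof -
      have "to_complex a \<in> \<real>" using 1 by blast
      then obtain r where "to_complex a = of_real r" by (auto simp: Reals_def)
      then have "to_complex a = to_complex (of_real r :: 'k)" by simp
      then show ?thesis unfolding to_complex_eq_iff by blast
    qed
    have "g (scale a y) = r * g y" if "a = of_real r" for a r y
      using that by (simp add: scale_of_real g_scale)
    then have "Vector_Spaces.linear scale (*) (\<lambda>y. of_real (g y) :: 'k)"
      using real by (intro linear_functionalI) (metis g_add of_real_add, metis of_real_mult)
    then show ?thesis by (intro exI[of _ "\<lambda>y. of_real (g y)"]) simp
  next
    case 2
    then obtain i :: 'k where i: "to_complex i = \<i>" by (metis surjD)
    have ii: "i * i = - 1"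
      by (subst to_complex_eq_iff[symmetric]) (simp add: to_complex_mult i)
    have decomp: "\<exists>r s. a = of_real r + of_real s * i" for a :: 'k
    proof -
      have "to_complex a = to_complex (of_real (Re (to_complex a)) + of_real (Im (to_complex a)) * i)"
        by (simp add: to_complex_add to_complex_mult i complex_eq_iff)
      then show ?thesis unfolding to_complex_eq_iff by blast
    qed
    \<comment> \<open>The standard complexification: the real part of f(iy) = i f(y) forces the
      imaginary part of f(y) to be - g(iy).\<close>
    define f where "f y = of_real (g y) - i * of_real (g (scale i y))" for y
    have f_add: "f (y + z) = f y + f z" for y z
      by (simp add: f_def g_add scale_right_distrib algebra_simps)
    have f_real: "f (scale (of_real r) y) = of_real r * f y" for r y
    proof -
      have "scale i (scale (of_real r) y) = r *\<^sub>R scale i y"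
        by (metis mult.commute scale_of_real scale_scale)
      then show ?thesis
        by (simp add: f_def g_scale scale_of_real algebra_simps)
    qed
    have f_i: "f (scale i y) = i * f y" for y
    proof -
      have "i * f y = i * of_real (g y) - (i * i) * of_real (g (scale i y))"
        by (simp add: f_def algebra_simps)
      then show ?thesis
        unfolding ii by (simp add: f_def ii g_neg algebra_simps)
    qed
    have "f (scale a y) = a * f y" for a y
    proof -
      obtain r s where a: "a = of_real r + of_real s * i" using decomp by blast
      have "f (scale a y) = f (scale (of_real r) y) + f (scale (of_real s) (scale i y))"
        by (simp add: a scale_left_distrib f_add)
      then show ?thesis
        by (simp only: a f_real f_i distrib_right mult.assoc)
    qed
    then have "Vector_Spaces.linear scale (*) f"
      using f_add by (intro linear_functionalI)
    moreover have "scalar_re (f y) = g y" for y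
    proof -
      have "f y = of_real (g y) + - (i * of_real (g (scale i y)))"
        by (simp add: f_def)
      then show ?thesis
        by (simp only: scalar_re_def to_complex_add to_complex_minus to_complex_mult i) simp
    qed
    ultimately show ?thesis by blast
  qed
qed

text \<open>Multiplying y by the conjugate of f y rotates the value to the real number |f y|^2,
  where the bound on real parts applies.\<close>

lemma norm_le_of_scalar_re_le:
  assumes f: "Vector_Spaces.linear scale (*) f" and re: "\<And>y. scalar_re (f y) \<le> norm y"
  shows "norm (f y) \<le> norm y"
proof (cases "f y = 0")
  case False
  have "scalar_re (f (scale (scalar_cnj (f y)) y)) = (norm (f y))\<^sup>2"
    by (simp only: linear_op_scale[OF f] scalar_cnj_mult_self scalar_re_of_real)
  then have "(norm (f y))\<^sup>2 \<le> norm (f y) * norm y"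
    using re[of "scale (scalar_cnj (f y)) y"] by (simp add: norm_scale)
  then show ?thesis using False by (simp add: power2_eq_square)
qed simp

text \<open>A pointwise bound replaces operator norm one, so that u = 0 is allowed; this matters
  because T x may vanish. For u \<noteq> 0 these are exactly the elements of J(u).\<close>

definition norming :: "'a \<Rightarrow> ('a \<Rightarrow> 'k) \<Rightarrow> bool"
  where "norming u f \<longleftrightarrow> Vector_Spaces.linear scale (*) f \<and> (\<forall>y. norm (f y) \<le> norm y) \<and>
    f u = of_real (norm u)"

text \<open>The cone consists of the pairs \<open>(t u + w, t \<parallel>u\<parallel>)\<close> with \<open>t \<ge> 0\<close> and
  \<open>w \<in> W\<close>; orthogonality says that it lies below the norm.\<close>

lemma norming_vanishing_on_orthogonal:
  assumes W: "subspace W" and orth: "W \<subseteq> bj_perp scale u"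
  shows "\<exists>f. norming u f \<and> (\<forall>w\<in>W. f w = 0)"
proof -
  note W0 = subspace_0[OF W] and W_add = subspace_add[OF W] and W_scale = subspace_scale[OF W]
  have W_scaleR: "t *\<^sub>R w \<in> W" if "w \<in> W" for t w
    using W_scale[OF that, of "of_real t"] by (simp add: scale_of_real)
  define G where "G = {(t *\<^sub>R u + w, t * norm u) |t w. 0 \<le> t \<and> w \<in> W}"
  have G_mem: "(t *\<^sub>R u + w, t * norm u) \<in> G" if "0 \<le> t" "w \<in> W" for t w
    using that by (auto simp: G_def)
  have "\<exists>g. linear g \<and> g \<le> norm \<and> (\<forall>(c, a) \<in> G. a \<le> g c)"
  proof (rule linear_between_graph_and_sublinear[OF sublinear_norm])
    show "0 \<in> G"
      using G_mem[OF order_refl W0] by (simp add: zero_prod_def)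
    show "v + v' \<in> G" if vv': "v \<in> G" "v' \<in> G" for v v'
    proof -
      obtain t w t' w' where "v = (t *\<^sub>R u + w, t * norm u)" "v' = (t' *\<^sub>R u + w', t' * norm u)"
        "0 \<le> t" "w \<in> W" "0 \<le> t'" "w' \<in> W"
        using vv' by (auto simp: G_def)
      then show ?thesis
        using G_mem[of "t + t'" "w + w'"] W_add by (simp add: algebra_simps)
    qed
    show "s *\<^sub>R v \<in> G" if s: "0 \<le> s" and v: "v \<in> G" for s v
    proof -
      obtain t w where "v = (t *\<^sub>R u + w, t * norm u)" "0 \<le> t" "w \<in> W"
        using v by (auto simp: G_def)
      then show ?thesis
        using s G_mem[of "s * t" "s *\<^sub>R w"] W_scaleR by (simp add: algebra_simps)
    qed
    show "a \<le> norm c" if ca: "(c, a) \<in> G" for c a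
    proof -
      obtain t w where c: "c = t *\<^sub>R u + w" "a = t * norm u" and t: "0 \<le> t" and w: "w \<in> W"
        using ca by (auto simp: G_def)
      show ?thesis
      proof (cases "t = 0")
        case False
        \<comment> \<open>Orthogonality is used with the scalar 1/t and then multiplied by
          t.\<close>
        have "bj_orthogonal scale u w"
          using orth w by (auto simp: bj_perp_def)
        then have "norm u \<le> norm (u + scale (of_real (inverse t)) w)"
          unfolding bj_orthogonal_def by blast
        then have "t * norm u \<le> t * norm (u + inverse t *\<^sub>R w)"
          using t by (simp only: scale_of_real mult_left_mono)
        also have "\<dots> = norm (t *\<^sub>R (u + inverse t *\<^sub>R w))"
          using t by simp
        finally show ?thesis
          using False by (simp add: c scaleR_add_right)
      qed (simp add: c)
    qed
  qed
  then obtain g where g: "linear g" "g \<le> norm" and gG: "\<And>c a. (c, a) \<in> G \<Longrightarrow> a \<le> g c"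
    by blast
  obtain f where f: "Vector_Spaces.linear scale (*) f" and re: "\<And>y. scalar_re (f y) = g y"
    using linear_functional_of_real_part[OF g(1)] by blast
  have bound: "norm (f y) \<le> norm y" for y
    using norm_le_of_scalar_re_le[OF f] re le_funD[OF g(2)] by simp
  have "norm u \<le> g u"
    using gG[OF G_mem[of 1 0]] W0 by simp
  then have "g u = norm u"
    using le_funD[OF g(2), of u] by simp
  then have "f u = of_real (norm u)"
    using bound re by (intro scalar_eq_of_real) auto
  moreover have "f w = 0" if "w \<in> W" for w
  proof -
    \<comment> \<open>The pairs with t = 0 give g \<ge> 0 on \<open>W\<close>; applied to v and -v
      this gives g = 0 there.\<close>
    have ge: "0 \<le> g v" if "v \<in> W" for v
      using gG[OF G_mem[of 0 v]] that by simp
    have zero: "g v = 0" if "v \<in> W" for v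
      using ge[OF that] ge[of "- v"] W_scaleR[OF that, of "- 1"] linear_neg[OF g(1), of v] by simp
    \<comment> \<open>So far only the real part of f is known to vanish on \<open>W\<close>. The
      rotated vector stays in \<open>W\<close>, so |f w|^2 is zero as well.\<close>
    have "scalar_re (f (scale (scalar_cnj (f w)) w)) = (norm (f w))\<^sup>2"
      by (simp only: linear_op_scale[OF f] scalar_cnj_mult_self scalar_re_of_real)
    then show ?thesis
      using zero[OF W_scale[OF that]] re by simp
  qed
  ultimately show ?thesis
    using f bound by (auto simp: norming_def)
qed

lemma norming_exists: "\<exists>f. norming u f"
  using norming_vanishing_on_orthogonal[of "{0}" u] subspace_single_0
  by (auto simp: bj_perp_def bj_orthogonal_def)

section \<open>Norming functionals as support functionals, and their kernels\<close>

lemma bounded_linear_functional: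
  assumes f: "Vector_Spaces.linear scale (*) f" and "\<And>y. norm (f y) \<le> norm y"
  shows "bounded_linear f"
proof (rule bounded_linear_intro[of _ 1])
  show "f (r *\<^sub>R y) = r *\<^sub>R f y" for r y
    using linear_op_scale[OF f, of "of_real r" y] by (simp add: scale_of_real scaleR_conv_of_real)
qed (use assms linear_op_add[OF f] in auto)

lemma support_functionals_eq:
  assumes "x \<noteq> 0"
  shows "support_functionals scale x = {f. norming x f}"
proof (intro equalityI subsetI)
  fix f assume "f \<in> support_functionals scale x"
  then have f: "Vector_Spaces.linear scale (*) f" "bounded_linear f" "onorm f = 1"
    "f x = of_real (norm x)"
    by (auto simp: support_functionals_def bounded_linear_op_def)
  then show "f \<in> {f. norming x f}"
    using onorm[OF f(2)] by (auto simp: norming_def)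
next
  fix f assume "f \<in> {f. norming x f}"
  then have f: "Vector_Spaces.linear scale (*) f" "\<And>y. norm (f y) \<le> norm y" "f x = of_real (norm x)"
    by (auto simp: norming_def)
  have bl: "bounded_linear f"
    using bounded_linear_functional[OF f(1,2)] .
  have "onorm f \<le> 1"
    using f(2) by (intro onorm_bound) auto
  moreover have "1 \<le> onorm f"
    using onorm[OF bl, of x] f(3) assms by simp
  ultimately show "f \<in> support_functionals scale x"
    using f bl by (auto simp: support_functionals_def bounded_linear_op_def)
qed

lemma kernel_subspace:
  assumes f: "Vector_Spaces.linear scale (*) f"
  shows "subspace {z. f z = 0}"
  using linear_op_add[OF f] linear_op_scale[OF f] linear_op_zero[OF f]
  by (auto intro!: subspaceI)

text \<open>Adding a multiple of z does not change the value of f, so |u| = |f(u + l z)| \<le> |u +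
  l z| in norms.\<close>

lemma kernel_orthogonal:
  assumes "norming u f" and "f z = 0"
  shows "bj_orthogonal scale u z"
  unfolding bj_orthogonal_def
proof
  fix l
  have f: "Vector_Spaces.linear scale (*) f" "norm (f (u + scale l z)) \<le> norm (u + scale l z)"
    "f u = of_real (norm u)"
    using assms(1) by (auto simp: norming_def)
  then show "norm u \<le> norm (u + scale l z)"
    using assms(2) by (simp add: linear_op_add[OF f(1)] linear_op_scale[OF f(1)])
qed


section \<open>Semi-inner products\<close>

lemma semi_inner_product_self:
  assumes "semi_inner_product scale p"
  shows "p y y = of_real ((norm y)\<^sup>2)"
proof -
  have add: "p (scale a v + scale b w) z = a * p v z + b * p w z" for a b v w z
    using assms unfolding semi_inner_product_def by blast
  have n: "norm y = sqrt (scalar_re (p y y))"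
    using assms unfolding semi_inner_product_def by blast
  show ?thesis
  proof (cases "y = 0")
    case True
    then show ?thesis using add[of 0 0 0 0 0] by simp
  next
    case False
    then have r: "p y y \<in> \<real>" "0 < scalar_re (p y y)"
      using assms unfolding semi_inner_product_def by blast+
    then have "(norm y)\<^sup>2 = scalar_re (p y y)"
      by (simp add: n)
    then show ?thesis
      using of_real_scalar_re[OF r(1)] by simp
  qed
qed

text \<open>The Cauchy-Schwarz axiom is the norm bound, and compatibility with the norm fixes the
  value at \<open>u\<close>. For u = 0 division by zero yields the zero functional, which is norming
  at 0.\<close>

lemma semi_inner_product_norming:
  assumes p: "semi_inner_product scale p"
  shows "norming u (\<lambda>y. p y u / of_real (norm u))"
proof -
  have lin: "p (scale a v + scale b w) z = a * p v z + b * p w z" for a b v w z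
    using p unfolding semi_inner_product_def by blast
  have add: "p (v + w) z = p v z + p w z" for v w z
    using lin[of 1 v 1 w z] by simp
  have scale: "p (scale a v) z = a * p v z" for a v z
    using lin[of a v 0 v z] by simp
  have "(norm (p y u))\<^sup>2 \<le> scalar_re (p y y) * scalar_re (p u u)" for y
    using p unfolding semi_inner_product_def by blast
  then have "(norm (p y u))\<^sup>2 \<le> (norm y * norm u)\<^sup>2" for y
    by (simp only: semi_inner_product_self[OF p] scalar_re_of_real power_mult_distrib)
  then have "norm (p y u) \<le> norm y * norm u" for y
    by (rule power2_le_imp_le) simp
  then have "norm (p y u / of_real (norm u)) \<le> norm y" for y
    by (cases "u = 0") (simp_all add: norm_divide divide_le_eq)
  moreover have "p u u / of_real (norm u) = of_real (norm u)"
    by (simp add: semi_inner_product_self[OF p] power2_eq_square)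
  ultimately show ?thesis
    unfolding norming_def
    by (intro conjI linear_functionalI) (auto simp: add scale add_divide_distrib)
qed

text \<open>On every line through the origin a representative is chosen, with \<open>u\<close> preferred on its own
  line; norming functionals at the representatives are then transported along the lines so as to be
  conjugate homogeneous.\<close>

lemma semi_inner_product_extending:
  assumes f: "norming u f"
  shows "\<exists>p. semi_inner_product scale p \<and> (\<forall>y. p y u = of_real (norm u) * f y)"
proof -
  \<comment> \<open>Only nonzero multiples are taken, so the lines are the orbits of scaling: they
    partition the space, with the origin as a class of its own.\<close>
  define line where "line z = {scale a z |a. a \<noteq> 0}" for z
  define rep where "rep z = (if u \<in> line z then u else SOME v. v \<in> line z)" for z
  define coord where "coord z = (SOME a. z = scale a (rep z))" for z
  define F where "F v = (if v = u then f else SOME h. norming v h)" for v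
  \<comment> \<open>With z = \<open>coord z\<close> times \<open>rep z\<close>, conjugate
    homogeneity dictates the factor \<open>scalar_cnj (coord z)\<close>.\<close>
  define p where "p y z = scalar_cnj (coord z) * of_real (norm (rep z)) * F (rep z) y" for y z
  have self: "z \<in> line z" for z
    unfolding line_def by (rule CollectI, rule exI[of _ 1]) simp
  have rep: "rep z \<in> line z" for z
    unfolding rep_def using someI[of "\<lambda>v. v \<in> line z", OF self] by simp
  have coord: "scale (coord z) (rep z) = z" for z
  proof -
    obtain a where "a \<noteq> 0" "rep z = scale a z"
      using rep[of z] by (auto simp: line_def)
    then have "z = scale (inverse a) (rep z)" by simp
    then show ?thesis unfolding coord_def by (rule someI[THEN sym])
  qed
  have "norming v (F v)" for v
    unfolding F_def using f someI_ex[OF norming_exists, of v] by auto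
  then have F: "Vector_Spaces.linear scale (*) (F v)" "norm (F v y) \<le> norm y"
    "F v v = of_real (norm v)" for v y
    by (auto simp: norming_def)
  have norm_coord: "norm (coord z) * norm (rep z) = norm z" for z
    using norm_scale[of "coord z" "rep z"] by (simp only: coord)
  have p_self: "p z z = of_real ((norm z)\<^sup>2)" for z
  proof -
    have "F (rep z) z = coord z * of_real (norm (rep z))"
      using linear_op_scale[OF F(1), of "rep z" "coord z" "rep z"] coord[of z] F(3) by simp
    then have "p z z = (scalar_cnj (coord z) * coord z) * of_real ((norm (rep z))\<^sup>2)"
      by (simp add: p_def power2_eq_square algebra_simps)
    also have "\<dots> = of_real ((norm (coord z) * norm (rep z))\<^sup>2)"
      by (simp only: scalar_cnj_mult_self of_real_mult power_mult_distrib)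
    finally show ?thesis by (simp only: norm_coord)
  qed
  have p_norm: "norm (p y z) \<le> norm y * norm z" for y z
  proof -
    have "norm (p y z) = norm z * norm (F (rep z) y)"
      using norm_coord[of z] by (simp add: p_def norm_mult)
    then show ?thesis
      using mult_left_mono[OF F(2) norm_ge_zero, of z "rep z" y] by (simp only: mult.commute)
  qed
  have p_cnj: "p y (scale a z) = scalar_cnj a * p y z" for a y z
  \<comment> \<open>When az = 0 the line of z may change and the coordinate is not unique, but both
    sides vanish by \<open>p_norm\<close>.\<close>
  proof (cases "a = 0 \<or> z = 0")
    case True
    then have "scale a z = 0" and "scalar_cnj a * p y z = 0"
      using p_norm[of y z] by auto
    moreover have "p y 0 = 0" using p_norm[of y 0] by simp
    ultimately show ?thesis by (simp only:)
  next
    case False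
    have "line (scale a z) = line z"
    proof (intro equalityI subsetI)
      fix v assume "v \<in> line (scale a z)"
      then obtain b where "b \<noteq> 0" "v = scale (b * a) z" by (auto simp: line_def)
      then show "v \<in> line z"
        using False unfolding line_def by (intro CollectI exI[of _ "b * a"]) auto
    next
      fix v assume "v \<in> line z"
      then obtain b where "b \<noteq> 0" "v = scale b z" by (auto simp: line_def)
      then show "v \<in> line (scale a z)"
        using False unfolding line_def by (intro CollectI exI[of _ "b / a"]) auto
    qed
    then have rep_eq: "rep (scale a z) = rep z" by (simp add: rep_def)
    \<comment> \<open>A nonzero representative can be cancelled, so the coordinate is
      unique.\<close>
    have "rep z \<noteq> 0" using False coord[of z] by auto
    moreover have "scale (coord (scale a z)) (rep z) = scale (a * coord z) (rep z)"
      using coord[of "scale a z"] coord[of z] by (simp only: rep_eq flip: scale_scale)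
    ultimately have "coord (scale a z) = a * coord z" by simp
    then show ?thesis by (simp add: p_def rep_eq scalar_cnj_mult)
  qed
  have p_lin: "p (scale a v + scale b w) z = a * p v z + b * p w z" for a b v w z
    by (simp add: p_def linear_op_add[OF F(1)] linear_op_scale[OF F(1)] algebra_simps)
  have "semi_inner_product scale p"
    unfolding semi_inner_product_def
  proof (intro conjI allI impI)
    show "(norm (p y z))\<^sup>2 \<le> scalar_re (p y y) * scalar_re (p z z)" for y z
      using power_mono[OF p_norm[of y z], of 2]
      by (simp only: p_self scalar_re_of_real power_mult_distrib norm_ge_zero)
  qed (simp_all only: p_lin p_cnj p_self scalar_re_of_real Reals_of_real real_sqrt_abs abs_norm_cancel
      zero_less_power2 norm_eq_zero not_False_eq_True)
  moreover have "p y u = of_real (norm u) * f y" for y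
  proof (cases "u = 0")
    case True
    then show ?thesis using p_norm[of y u] by simp
  next
    case False
    \<comment> \<open>Preferring \<open>u\<close> on its own line makes its coordinate 1 and its
      chosen functional \<open>f\<close>.\<close>
    have rep_u: "rep u = u" using self by (simp add: rep_def)
    then have "scale (coord u) u = scale 1 u" using coord[of u] by simp
    then have "coord u = 1" using False by (simp del: scale_one)
    then show ?thesis by (simp add: p_def rep_u F_def)
  qed
  ultimately show ?thesis by blast
qed

end


section \<open>Level vectors\<close>

theorem proposition2p1:
  fixes sX :: "'k::real_or_complex \<Rightarrow> 'a::real_normed_vector \<Rightarrow> 'a"
    and sY :: "'k \<Rightarrow> 'b::real_normed_vector \<Rightarrow> 'b"
    and T :: "'a \<Rightarrow> 'b"
    and x :: 'a
  assumes "normed_space_over sX"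
    and "normed_space_over sY"
    and "bounded_linear_op sX sY T"
    and "x \<noteq> 0"
  shows "level_vector sX sY T x \<longleftrightarrow>
    (\<exists>f \<in> support_functionals sX x. preserves_bj_at sX sY T x {z. f z = 0})"
proof -
  interpret X: normed_space_over sX by fact
  interpret Y: normed_space_over sY by fact
  have T: "Vector_Spaces.linear sX sY T"
    using assms(3) by (simp add: bounded_linear_op_def)
  note J = X.support_functionals_eq[OF \<open>x \<noteq> 0\<close>]
  show ?thesis
  proof
    assume "level_vector sX sY T x"
    then obtain k p q where p: "semi_inner_product sX p" and q: "semi_inner_product sY q"
      and pq: "\<And>y. q (T y) (T x) = k * p y x"
      by (auto simp: level_vector_def level_number_def)
    let ?f = "\<lambda>y. p y x / of_real (norm x)"
    have f: "X.norming x ?f"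
      using X.semi_inner_product_norming[OF p] .
    \<comment> \<open>On the kernel of \<open>?f\<close> the level equation gives q(Tz, Tx) = 0, so
      Tz lies in the kernel of the norming functional of \<open>q\<close> at Tx.\<close>
    have "bj_orthogonal sY (T x) (T z)" if "?f z = 0" for z
      using Y.kernel_orthogonal[OF Y.semi_inner_product_norming[OF q]] pq[of z] that \<open>x \<noteq> 0\<close>
      by simp
    then have "preserves_bj_at sX sY T x {z. ?f z = 0}"
      using X.kernel_orthogonal[OF f] X.kernel_subspace[of ?f] f
      unfolding preserves_bj_at_def bj_perp_def X.norming_def by auto
    then show "\<exists>f \<in> support_functionals sX x. preserves_bj_at sX sY T x {z. f z = 0}"
      unfolding J using f by (intro bexI[of _ ?f]) auto
  next
    assume "\<exists>f \<in> support_functionals sX x. preserves_bj_at sX sY T x {z. f z = 0}"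
    then obtain f where f: "X.norming x f" and pres: "preserves_bj_at sX sY T x {z. f z = 0}"
      using J by auto
    have f_lin: "Vector_Spaces.linear sX (*) f" and f_x: "f x = of_real (norm x)"
      using f by (auto simp: X.norming_def)
    let ?W = "T ` {z. f z = 0}"
    have "Y.subspace ?W"
      using module_hom.subspace_image[OF module_hom_linearI[OF T] X.kernel_subspace[OF f_lin]] .
    moreover have "?W \<subseteq> bj_perp sY (T x)"
      using pres by (auto simp: preserves_bj_at_def bj_perp_def)
    ultimately have "\<exists>g. Y.norming (T x) g \<and> (\<forall>w \<in> ?W. g w = 0)"
      by (rule Y.norming_vanishing_on_orthogonal)
    then obtain g where g: "Y.norming (T x) g" and g_W: "\<And>z. f z = 0 \<Longrightarrow> g (T z) = 0"
      by auto
    have g_lin: "Vector_Spaces.linear sY (*) g" and g_Tx: "g (T x) = of_real (norm (T x))"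
      using g by (auto simp: Y.norming_def)
    \<comment> \<open>Subtracting the multiple of x with the same f-value puts y into the kernel of
      f, where g composed with T vanishes; hence this composition is a multiple of f.\<close>
    have g_T: "g (T y) = f y / of_real (norm x) * of_real (norm (T x))" for y
    proof -
      define a where "a = f y / of_real (norm x)"
      have "f (y - sX a x) = 0"
        using \<open>x \<noteq> 0\<close> by (simp add: linear_op_diff[OF f_lin] linear_op_scale[OF f_lin] f_x a_def)
      then have "g (T (y - sX a x)) = 0" by (rule g_W)
      then show ?thesis
        by (simp add: linear_op_diff[OF T] linear_op_scale[OF T] linear_op_diff[OF g_lin]
            linear_op_scale[OF g_lin] g_Tx a_def)
    qed
    obtain p where p: "semi_inner_product sX p" "\<And>y. p y x = of_real (norm x) * f y"
      using X.semi_inner_product_extending[OF f] by blast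
    obtain q where q: "semi_inner_product sY q" "\<And>y. q y (T x) = of_real (norm (T x)) * g y"
      using Y.semi_inner_product_extending[OF g] by blast
    \<comment> \<open>The level number is forced by y = x, where the two sides are the squared norms
      of Tx and x. It is 0 when Tx = 0.\<close>
    have "q (T y) (T x) = of_real ((norm (T x))\<^sup>2 / (norm x)\<^sup>2) * p y x" for y
      using \<open>x \<noteq> 0\<close> by (simp add: p q g_T power2_eq_square field_simps)
    then show "level_vector sX sY T x"
      using p q \<open>x \<noteq> 0\<close> unfolding level_vector_def level_number_def by blast
  qed
qed

end
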